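(* Let $q=p^k$ for some prime $p\ne 3$ and some integer $k>0$. Let $Q,R,S$ be integers each of the form $p^i$ for some integer $i\ge 0$ (the exponents may differ). Let $r>0$ be an integer with $r\equiv Q+R+S\pmod{q+1}$. Let $f(X):=X^rB(X^{q-1})$, where one of the following holds: (1) $B(X):=X^{Q+R+S}-X^Q-X^R-X^S+1$ and $(Q,R,S)\equiv\pm(1,1,1)\pmod 3$; (2) $B(X):=X^{Q+R+S}-X^Q-X^R-X^S-1$ and $(Q,R,S)\equiv\pm(1,1,1)\pmod 3$; (3) $B(X):=X^{Q+R}-X^{Q+S}-X^{R+S}+X^S-1$ and $(Q,R,S)\equiv\pm(1,1,-1)\pmod 3$; (4) $B(X):=X^{Q+R}-X^{Q+S}-X^{R+S}-X^S-1$ and $(Q,R,S)\equiv\pm(1,1,-1)\pmod 3$. Then $f(X)$ permutes $\mathbb{F}_{q^2}$ if and only if $\gcd(r,q-1)=1$ and one of the following holds: (i) $q\equiv 1\pmod 3$ and $\gcd(Q+R+S,q+1)=1$; (ii) $q\equiv -1\pmod 3$ and $\gcd(Q+R+S,q-1)=1$.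
   Context: A polynomial $f(X)\in\mathbb{F}_{q^2}[X]$ permutes $\mathbb{F}_{q^2}$ if the map $\alpha\mapsto f(\alpha)$ is a bijection of $\mathbb{F}_{q^2}$. For integers $\epsilon_1,\epsilon_2,\epsilon_3$, the notation $(Q,R,S)\equiv\pm(\epsilon_1,\epsilon_2,\epsilon_3)\pmod 3$ means that there is a single sign $s\in\{1,-1\}$ with $Q\equiv s\epsilon_1$, $R\equiv s\epsilon_2$, $S\equiv s\epsilon_3\pmod 3$. *)

theory Defs
  imports "HOL-Computational_Algebra.Computational_Algebra" "HOL-Number_Theory.Cong"
begin

definition permutation_poly :: "'a::{field,finite} poly \<Rightarrow> bool" where
  "permutation_poly f \<longleftrightarrow> bij (poly f)"

text \<open>A single sign is shared by the three congruences.\<close>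

definition cong3_pm :: "nat \<Rightarrow> nat \<Rightarrow> nat \<Rightarrow> int \<Rightarrow> int \<Rightarrow> int \<Rightarrow> bool" where
  "cong3_pm Q R S e1 e2 e3 \<longleftrightarrow>
     (\<exists>s\<in>{1, -1::int}. [int Q = s * e1] (mod 3) \<and> [int R = s * e2] (mod 3) \<and> [int S = s * e3] (mod 3))"

end

theory Submission
  imports Defs
begin

text \<open>
  Write \<open>\<mu>\<close> for the group of \<open>(q + 1)\<close>-st roots of unity in the field with \<open>q\<^sup>2\<close> elements, that is,
  the image of \<open>x \<mapsto> x ^ (q - 1)\<close>. Since \<open>f x ^ (q - 1)\<close> depends only on \<open>s = x ^ (q - 1)\<close>, the map \<open>f\<close>
  is injective iff \<open>gcd r (q - 1) = 1\<close> and the induced map \<open>g s = s ^ r * B s ^ (q - 1)\<close> is injective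
  on \<open>\<mu>\<close>, provided that \<open>B\<close> has no zero on \<open>\<mu>\<close> (\<open>inj_power_poly_iff\<close>).

  The point is that \<open>g\<close> is a power map in disguise. Put \<open>n = Q + R + S\<close> and let \<open>v\<close> be a primitive cube
  root of unity; it lies in the field because \<open>3\<close> divides \<open>q\<^sup>2 - 1\<close>. As \<open>Q\<close>, \<open>R\<close>, \<open>S\<close> are powers of the
  characteristic, \<open>(x + v) ^ n\<close> is the product of \<open>x ^ Q + v ^ Q\<close>, \<open>x ^ R + v ^ R\<close> and
  \<open>x ^ S + v ^ S\<close>, and the congruences modulo 3 say which of the two primitive cube roots occurs in each
  factor. Expanding the products shows that, for the first and the third polynomial \<open>B\<close>, both
  \<open>B x\<close> and \<open>x ^ n * B x ^ q\<close> are linear combinations of \<open>(x + v) ^ n\<close> and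
  \<open>(x + v\<^sup>2) ^ n\<close> for \<open>x\<close> in \<open>\<mu>\<close>, and the two combinations are independent. So \<open>B\<close> has no zero on
  \<open>\<mu>\<close>, and \<open>g\<close> arises from \<open>u \<mapsto> u ^ n\<close> by the substitution \<open>u = (x + v) / (x + v\<^sup>2)\<close> followed by
  a Moebius transformation (\<open>moebius_power_inj_iff\<close>). The other two polynomials reduce to these by
  \<open>x \<mapsto> - x\<close>.

  It remains to see where \<open>u\<close> lives. If \<open>q\<close> is 1 modulo 3, then \<open>v\<close> is fixed by the \<open>q\<close>-power map, and
  \<open>u\<close> runs through a coset of \<open>\<mu>\<close>; if \<open>q\<close> is \<open>-1\<close> modulo 3, then \<open>v\<close> and \<open>v\<^sup>2\<close> are swapped, and \<open>u\<close>
  runs through a scalar multiple of the projective line over the field with \<open>q\<close> elements. The \<open>n\<close>-th power map is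
  injective there iff \<open>n\<close> is coprime to \<open>q + 1\<close> or to \<open>q - 1\<close>, respectively
  (\<open>cross_injective_iff\<close>).
\<close>

section \<open>Roots of unity in finite fields\<close>

text \<open>The translation by 1 permutes the ring, so it does not change the sum of all elements.\<close>
lemma of_nat_card_UNIV_eq_0:
  "of_nat (card (UNIV :: 'a set)) = (0 :: 'a::{comm_ring_1,finite})"
proof -
  have "(\<Sum>x\<in>UNIV. x + 1) = (\<Sum>x\<in>(UNIV :: 'a set). x)"
    by (rule sum.reindex_bij_witness[of _ "\<lambda>x. x - 1" "\<lambda>x. x + 1"]) auto
  then show ?thesis
    by (simp add: sum.distrib)
qed

lemma CHAR_of_card_prime_power:
  assumes "prime p" and "card (UNIV :: 'a::{field,finite} set) = p ^ m"
  shows "CHAR('a) = p"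
proof -
  have "CHAR('a) dvd p ^ m"
    using of_nat_card_UNIV_eq_0[where 'a = 'a] assms(2) by (metis of_nat_eq_0_iff_char_dvd)
  moreover have "prime CHAR('a)"
    by (intro prime_CHAR_semidom finite_imp_CHAR_pos) simp
  ultimately show ?thesis
    using assms(1) by (metis prime_dvd_power primes_dvd_imp_eq)
qed

text \<open>Multiplication by \<open>x\<close> permutes the nonzero elements, so it does not change their product.\<close>
lemma power_card_UNIV_minus_1:
  fixes x :: "'a::{field,finite}"
  assumes "x \<noteq> 0"
  shows "x ^ (card (UNIV :: 'a set) - 1) = 1"
proof -
  have "(\<Prod>y\<in>UNIV-{0}. x * y) = (\<Prod>y\<in>UNIV-{0}. y)"
    by (rule prod.reindex_bij_witness[of _ "\<lambda>y. y / x" "\<lambda>y. x * y"]) (use assms in auto)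
  then have "x ^ (card (UNIV :: 'a set) - 1) * \<Prod>(UNIV-{0}) = \<Prod>(UNIV-{0})"
    by (simp add: prod.distrib)
  then show ?thesis
    by simp
qed

definition unity_roots :: "nat \<Rightarrow> 'a::field set" where
  "unity_roots d = {x. x ^ d = 1}"

lemma unity_roots_iff: "x \<in> unity_roots d \<longleftrightarrow> x ^ d = 1"
  by (simp add: unity_roots_def)

lemma card_power_eq_le:
  fixes c :: "'a::field"
  assumes "d > 0"
  shows "card {x. x ^ d = c} \<le> d"
proof -
  have deg: "degree (monom 1 d + [:- c:]) = d"
    using assms by (subst degree_add_eq_left) (auto simp: degree_monom_eq)
  then have "monom 1 d + [:- c:] \<noteq> 0"
    using assms by auto
  from card_poly_roots_bound[OF this] show ?thesis
    by (simp add: deg poly_monom)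
qed

text \<open>
  A count that replaces the cyclicity of the multiplicative group: the \<open>d * e\<close> nonzero elements are mapped
  by \<open>x \<mapsto> x ^ e\<close> into the \<open>d\<close>-th roots of unity, of which there are at most \<open>d\<close>, and every fibre has at
  most \<open>e\<close> elements. Hence both bounds are attained.
\<close>
lemma power_image_unity_roots:
  fixes d e :: nat
  assumes "d * e = card (UNIV :: 'a::{field,finite} set) - 1"
  shows "(\<lambda>x. x ^ e) ` (UNIV - {0}) = (unity_roots d :: 'a set)"
    and "card (unity_roots d :: 'a set) = d"
proof -
  let ?N = "UNIV - {0 :: 'a}" and ?h = "\<lambda>x :: 'a. x ^ e"
  have "card (UNIV :: 'a set) \<ge> card {0, 1 :: 'a}"
    by (intro card_mono) auto
  then have N: "card ?N = d * e" "d * e > 0"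
    using assms by auto
  have sub: "?h ` ?N \<subseteq> unity_roots d"
  proof (rule image_subsetI)
    fix x :: 'a assume "x \<in> UNIV - {0}"
    then have "x \<noteq> 0"
      by simp
    then have "(x ^ e) ^ d = 1"
      using power_card_UNIV_minus_1 assms by (metis mult.commute power_mult)
    then show "x ^ e \<in> unity_roots d"
      by (simp add: unity_roots_iff)
  qed
  have "?N = (\<Union>c\<in>?h ` ?N. {x \<in> ?N. ?h x = c})"
    by auto
  then have "d * e \<le> (\<Sum>c\<in>?h ` ?N. card {x \<in> ?N. ?h x = c})"
    using N card_UN_le[of "?h ` ?N" "\<lambda>c. {x \<in> ?N. ?h x = c}"] by simp
  also have "\<dots> \<le> (\<Sum>c\<in>?h ` ?N. e)"
  proof (intro sum_mono)
    fix c
    have "card {x \<in> ?N. ?h x = c} \<le> card {x. ?h x = c}"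
      by (intro card_mono) auto
    also have "\<dots> \<le> e"
      using N by (intro card_power_eq_le) simp
    finally show "card {x \<in> ?N. ?h x = c} \<le> e" .
  qed
  finally have "d \<le> card (?h ` ?N)"
    using N by simp
  moreover have "card (?h ` ?N) \<le> card (unity_roots d :: 'a set)"
    using sub by (intro card_mono) auto
  moreover have "card (unity_roots d :: 'a set) \<le> d"
    unfolding unity_roots_def using N by (intro card_power_eq_le) simp
  ultimately have "card (?h ` ?N) = card (unity_roots d :: 'a set)" "card (unity_roots d :: 'a set) = d"
    by simp_all
  then show "?h ` ?N = unity_roots d" "card (unity_roots d :: 'a set) = d"
    using sub by (simp_all add: card_subset_eq)
qed

text \<open>The inverse of the \<open>n\<close>-th power map is the \<open>m\<close>-th power map with \<open>m\<close> inverse to \<open>n\<close> modulo \<open>d\<close>.\<close>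
lemma power_inverse_on_unity_roots:
  assumes "coprime n d"
  obtains m where "\<And>c :: 'a::field. c \<in> unity_roots d \<Longrightarrow> c ^ (n * m) = c"
proof -
  obtain m where "[n * m = Suc 0] (mod d)"
    using assms cong_solve_coprime_nat by blast
  then obtain i j where ij: "n * m + d * i = 1 + d * j"
    by (metis One_nat_def cong_iff_lin_nat mult.commute)
  have "c ^ (n * m) = c" if "c \<in> unity_roots d" for c :: 'a
  proof -
    have "c ^ (n * m + d * i) = c ^ (1 + d * j)"
      by (simp only: ij)
    then show ?thesis
      using that by (simp add: power_add power_mult[of c d] unity_roots_iff)
  qed
  then show ?thesis
    using that by blast
qed

lemma coprime_unity_root_eq_1:
  fixes z :: "'a::field"
  assumes "gcd n d = 1" and "z ^ n = 1" and "z ^ d = 1"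
  shows "z = 1"
proof -
  obtain m where "z ^ (n * m) = z"
    using power_inverse_on_unity_roots assms by (metis coprime_iff_gcd_eq_1 unity_roots_iff)
  then show ?thesis
    using assms(2) by (simp add: power_mult)
qed

text \<open>A root of unity of order dividing \<open>gcd n d\<close> is the obstruction to injectivity of \<open>n\<close>-th powers.\<close>
lemma nontrivial_common_unity_root:
  fixes n d :: nat
  assumes "d dvd card (UNIV :: 'a::{field,finite} set) - 1" and "gcd n d \<noteq> 1"
  obtains z :: "'a::{field,finite}" where "z \<noteq> 1" "z ^ n = 1" "z ^ d = 1"
proof -
  have "gcd n d dvd card (UNIV :: 'a set) - 1"
    using assms(1) by (metis dvd_trans gcd_dvd2)
  then have "card (unity_roots (gcd n d) :: 'a set) \<noteq> 1"
    using assms(2) power_image_unity_roots(2)[where 'a = 'a, of "gcd n d"] by (metis dvdE)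
  then have "unity_roots (gcd n d) \<noteq> {1 :: 'a}"
    by auto
  moreover have "1 \<in> unity_roots (gcd n d)"
    by (simp add: unity_roots_iff)
  ultimately obtain z :: 'a where "z \<in> unity_roots (gcd n d)" and "z \<noteq> 1"
    by blast
  then have z: "z ^ gcd n d = 1" "z \<noteq> 1"
    by (simp_all add: unity_roots_iff)
  have "z ^ n = 1" "z ^ d = 1"
    using z(1) by (metis dvd_def gcd_dvd1 power_mult power_one, metis dvd_def gcd_dvd2 power_mult power_one)
  then show ?thesis
    using that z by blast
qed


section \<open>Reduction to the group of norm-one elements\<close>

text \<open>The parameter \<open>T\<close> only ties the type of field elements to the numbers \<open>p\<close>, \<open>k\<close>, \<open>q\<close>.\<close>
locale quadratic_finite_field =
  fixes p k q :: nat and T :: "'a::{field,finite} itself"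
  assumes prime_p: "prime p" and k_pos: "k > 0" and q_def: "q = p ^ k"
    and card_field: "card (UNIV :: 'a set) = q ^ 2"
begin

abbreviation \<mu> :: "'a set" where
  "\<mu> \<equiv> unity_roots (q + 1)"

lemma q_gt_1: "q > 1"
  using one_less_power[OF prime_gt_1_nat[OF prime_p] k_pos] by (simp add: q_def)

lemma card_minus_1: "card (UNIV :: 'a set) - 1 = (q + 1) * (q - 1)"
  using q_gt_1 by (simp add: card_field power2_eq_square algebra_simps)

lemma dvd_card_minus_1:
  "q + 1 dvd card (UNIV :: 'a set) - 1" "q - 1 dvd card (UNIV :: 'a set) - 1"
  unfolding card_minus_1 by (rule dvd_triv_left, rule dvd_triv_right)

lemma CHAR_eq_p: "CHAR('a) = p"
  using CHAR_of_card_prime_power[where 'a = 'a, OF prime_p, of "k * 2"]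
  by (simp add: card_field q_def power_mult)

lemma frobenius: "(x + y :: 'a) ^ p ^ i = x ^ p ^ i + y ^ p ^ i"
  using freshmans_dream'[where 'a = 'a, of "p ^ i" i] prime_p by (simp add: CHAR_eq_p)

text \<open>Additivity of the Frobenius map gives this in every characteristic, including 2.\<close>
lemma frobenius_minus: "(- x :: 'a) ^ p ^ i = - (x ^ p ^ i)"
  using frobenius[of "- x" x i] prime_gt_0_nat[OF prime_p]
  by (simp add: eq_neg_iff_add_eq_0 power_0_left)

lemma frobenius_diff: "(x - y :: 'a) ^ p ^ i = x ^ p ^ i - y ^ p ^ i"
  using frobenius[of x "- y" i] by (simp add: frobenius_minus)

lemmas frobenius_q = frobenius[of _ _ k, folded q_def]

lemmas frobenius_diff_q = frobenius_diff[of _ _ k, folded q_def]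

lemma mu_power_q: "x \<in> \<mu> \<Longrightarrow> x * x ^ q = 1"
  by (simp add: unity_roots_iff)

lemma mu_nonzero: "x \<in> \<mu> \<Longrightarrow> x \<noteq> 0"
  by (auto simp: unity_roots_iff)

lemma card_mu: "card \<mu> = q + 1"
  using power_image_unity_roots(2) card_minus_1 by metis

lemma mu_eq_image: "\<mu> = (\<lambda>x. x ^ (q - 1)) ` (UNIV - {0})"
  using power_image_unity_roots(1)[where 'a = 'a, of "q + 1" "q - 1"] card_minus_1 by simp

text \<open>
  The map \<open>x \<mapsto> x ^ (q - 1)\<close> from nonzero elements onto \<open>\<mu>\<close> intertwines \<open>f\<close> with \<open>g\<close>, and its fibres are
  the cosets of the group of \<open>(q - 1)\<close>-st roots of unity, on which \<open>f\<close> acts as a multiple of the \<open>r\<close>-th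
  power map. So injectivity of \<open>f\<close> splits into injectivity on the fibres and on the base.
\<close>
lemma inj_power_poly_iff:
  fixes B :: "'a \<Rightarrow> 'a"
  assumes "r > 0" and nz: "\<And>s. s \<in> \<mu> \<Longrightarrow> B s \<noteq> 0"
  shows "inj (\<lambda>x. x ^ r * B (x ^ (q - 1))) \<longleftrightarrow>
           gcd r (q - 1) = 1 \<and> inj_on (\<lambda>s. s ^ r * B s ^ (q - 1)) \<mu>"
    (is "inj ?f \<longleftrightarrow> _ \<and> inj_on ?g \<mu>")
proof -
  have mu: "x ^ (q - 1) \<in> \<mu>" if "x \<noteq> 0" for x :: 'a
    using that unfolding mu_eq_image by blast
  have f0: "?f x = 0 \<longleftrightarrow> x = 0" for x
    using nz[OF mu] \<open>r > 0\<close> by auto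
  have f_power: "?f x ^ (q - 1) = ?g (x ^ (q - 1))" for x
    by (simp add: power_mult_distrib mult.commute flip: power_mult)
  have f_scale: "?f (c * x) = c ^ r * ?f x" if "c ^ (q - 1) = 1" for c x
    using that by (simp add: power_mult_distrib)
  show ?thesis
  proof (intro iffI conjI)
    assume inj: "inj ?f"
    show gcd: "gcd r (q - 1) = 1"
    proof (rule ccontr)
      assume "gcd r (q - 1) \<noteq> 1"
      then obtain z :: 'a where "z \<noteq> 1" "z ^ r = 1" "z ^ (q - 1) = 1"
        using nontrivial_common_unity_root dvd_card_minus_1(2) by blast
      then have "?f z = ?f 1"
        by simp
      then show False
        using inj \<open>z \<noteq> 1\<close> by (blast dest: injD)
    qed
    show "inj_on ?g \<mu>"
    proof (rule inj_onI)
      fix s t assume st: "s \<in> \<mu>" "t \<in> \<mu>" "?g s = ?g t"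
      then obtain x y where x: "x \<noteq> 0" "s = x ^ (q - 1)" and y: "y \<noteq> 0" "t = y ^ (q - 1)"
        unfolding mu_eq_image by blast
      \<comment> \<open>The quotient \<open>c\<close> is an \<open>r\<close>-th power of some \<open>(q - 1)\<close>-st root of unity, which moves \<open>y\<close> to \<open>x\<close>.\<close>
      define c where "c = ?f x / ?f y"
      have "?f x ^ (q - 1) = ?f y ^ (q - 1)"
        using st(3) unfolding f_power x y .
      moreover have "?f y \<noteq> 0"
        using f0 y by blast
      ultimately have c: "c \<in> unity_roots (q - 1)" "?f x = c * ?f y"
        by (auto simp: c_def power_divide unity_roots_iff)
      obtain m where "c ^ (r * m) = c"
        using power_inverse_on_unity_roots gcd c(1) by (metis coprime_iff_gcd_eq_1)
      moreover have d: "(c ^ m) ^ (q - 1) = 1"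
        using c(1) by (metis mult.commute power_mult power_one unity_roots_iff)
      ultimately have "?f (c ^ m * y) = ?f x"
        by (simp only: f_scale c(2)) (simp add: mult.commute flip: power_mult)
      then have "x = c ^ m * y"
        using inj by (blast dest: injD)
      then show "s = t"
        using x y d by (simp add: power_mult_distrib)
    qed
  next
    assume *: "gcd r (q - 1) = 1 \<and> inj_on ?g \<mu>"
    show "inj ?f"
    proof (rule injI)
      fix x y assume eq: "?f x = ?f y"
      show "x = y"
      proof (cases "y = 0")
        case True
        then show ?thesis
          using eq f0 by metis
      next
        case False
        then have "x \<noteq> 0"
          using eq f0 by metis
        have "?g (x ^ (q - 1)) = ?g (y ^ (q - 1))"
          using eq unfolding f_power[symmetric] by simp
        then have same: "x ^ (q - 1) = y ^ (q - 1)"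
          using * mu False \<open>x \<noteq> 0\<close> by (auto dest: inj_onD)
        define c where "c = x / y"
        have c: "c \<in> unity_roots (q - 1)" "x = c * y"
          using False same by (auto simp: c_def power_divide unity_roots_iff)
        then have "c ^ r * ?f y = ?f y"
          using eq f_scale[of c y] by (simp add: unity_roots_iff)
        then have "c ^ r = 1"
          using False f0[of y] by simp
        then have "c = 1"
          using coprime_unity_root_eq_1 * c(1) unity_roots_iff by metis
        then show ?thesis
          using c by simp
      qed
    qed
  qed
qed

text \<open>
  Multiplication by \<open>e\<close> permutes \<open>\<mu>\<close> and only rescales the induced map. The choice \<open>e = - 1\<close> reduces two
  of the four polynomials to the other two.
\<close>
lemma mu_scale_iff:
  fixes B b :: "'a \<Rightarrow> 'a"
  assumes e: "e \<in> \<mu>" and s: "s \<noteq> 0" and B: "\<And>x. x \<in> \<mu> \<Longrightarrow> B (e * x) = s * b x"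
  shows "(\<forall>x\<in>\<mu>. B x \<noteq> 0) \<longleftrightarrow> (\<forall>x\<in>\<mu>. b x \<noteq> 0)"
    and "inj_on (\<lambda>x. x ^ r * B x ^ (q - 1)) \<mu> \<longleftrightarrow> inj_on (\<lambda>x. x ^ r * b x ^ (q - 1)) \<mu>"
    (is "inj_on ?G \<mu> \<longleftrightarrow> inj_on ?g \<mu>")
proof -
  have e0: "e \<noteq> 0"
    using e by (rule mu_nonzero)
  have bij: "(\<lambda>x. e * x) ` \<mu> = \<mu>"
  proof (rule card_subset_eq)
    show "(\<lambda>x. e * x) ` \<mu> \<subseteq> \<mu>"
      using e by (auto simp: unity_roots_iff power_mult_distrib simp del: power_Suc)
    show "card ((\<lambda>x. e * x) ` \<mu>) = card \<mu>"
      using e0 by (intro card_image inj_onI) simp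
  qed simp
  have "(\<forall>x\<in>\<mu>. B x \<noteq> 0) \<longleftrightarrow> (\<forall>x\<in>(\<lambda>x. e * x) ` \<mu>. B x \<noteq> 0)"
    by (simp only: bij)
  also have "\<dots> \<longleftrightarrow> (\<forall>x\<in>\<mu>. b x \<noteq> 0)"
    using s B by auto
  finally show "(\<forall>x\<in>\<mu>. B x \<noteq> 0) \<longleftrightarrow> (\<forall>x\<in>\<mu>. b x \<noteq> 0)" .
  have "inj_on (?G \<circ> (\<lambda>x. e * x)) \<mu> \<longleftrightarrow> inj_on ?G \<mu>"
    using e0 comp_inj_on_iff[of "\<lambda>x. e * x" \<mu> ?G] unfolding bij by (simp add: inj_on_def)
  moreover have "(?G \<circ> (\<lambda>x. e * x)) x = (e ^ r * s ^ (q - 1)) * ?g x" if "x \<in> \<mu>" for x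
    using B[OF that] by (simp add: power_mult_distrib mult_ac)
  then have "inj_on (?G \<circ> (\<lambda>x. e * x)) \<mu> \<longleftrightarrow> inj_on (\<lambda>x. (e ^ r * s ^ (q - 1)) * ?g x) \<mu>"
    by (rule inj_on_cong)
  ultimately show "inj_on ?G \<mu> \<longleftrightarrow> inj_on ?g \<mu>"
    using e0 s by (simp add: inj_on_def)
qed


section \<open>Powers conjugated by a Moebius transformation\<close>

text \<open>
  Injectivity of \<open>x \<mapsto> u x ^ n\<close> on \<open>\<mu>\<close>, where \<open>u x = (x + v) / (x + v\<^sup>2)\<close>, in a form cleared of
  denominators: for \<open>v\<close> a primitive cube root of unity, the value infinity of \<open>u\<close> is included.
\<close>
definition cross_injective :: "'a \<Rightarrow> nat \<Rightarrow> bool" where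
  "cross_injective v n \<longleftrightarrow>
     (\<forall>x\<in>\<mu>. \<forall>y\<in>\<mu>. ((x + v) * (y + v ^ 2)) ^ n = ((y + v) * (x + v ^ 2)) ^ n \<longrightarrow> x = y)"

text \<open>
  Since \<open>x ^ r = x ^ n\<close> on \<open>\<mu>\<close>, the map in question is the quotient of \<open>x ^ n * b x ^ q\<close> by \<open>b x\<close>,
  that is, a Moebius transformation with determinant \<open>c1 * d2 - c2 * d1\<close>, up to sign, applied to
  \<open>((x + v) / (x + v\<^sup>2)) ^ n\<close>. A common zero of numerator and denominator would force
  \<open>x + v = 0 = x + v\<^sup>2\<close>.
\<close>
lemma moebius_power_inj_iff:
  fixes b :: "'a \<Rightarrow> 'a"
  assumes v: "v ^ 2 \<noteq> v" and "n > 0" and r: "[r = n] (mod (q + 1))"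
    and "\<kappa> \<noteq> 0" and det: "c1 * d2 \<noteq> c2 * d1"
    and den: "\<And>x. x \<in> \<mu> \<Longrightarrow> \<kappa> * b x = c1 * (x + v) ^ n + c2 * (x + v ^ 2) ^ n"
    and num: "\<And>x. x \<in> \<mu> \<Longrightarrow> \<kappa> * (x ^ n * b x ^ q) = d1 * (x + v) ^ n + d2 * (x + v ^ 2) ^ n"
  shows "\<And>x. x \<in> \<mu> \<Longrightarrow> b x \<noteq> 0"
    and "inj_on (\<lambda>x. x ^ r * b x ^ (q - 1)) \<mu> \<longleftrightarrow> cross_injective v n"
proof -
  let ?P = "\<lambda>x. (x + v) ^ n" and ?M = "\<lambda>x. (x + v ^ 2) ^ n" and ?g = "\<lambda>x. x ^ r * b x ^ (q - 1)"
  show nz: "b x \<noteq> 0" if x: "x \<in> \<mu>" for x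
  proof
    assume "b x = 0"
    then have 0: "c1 * ?P x + c2 * ?M x = 0" "d1 * ?P x + d2 * ?M x = 0"
      using den[OF x] num[OF x] q_gt_1 by (simp_all add: power_0_left)
    have "(c1 * d2 - c2 * d1) * ?P x = d2 * (c1 * ?P x + c2 * ?M x) - c2 * (d1 * ?P x + d2 * ?M x)"
         "(c1 * d2 - c2 * d1) * ?M x = c1 * (d1 * ?P x + d2 * ?M x) - d1 * (c1 * ?P x + c2 * ?M x)"
      by algebra+
    then have "?P x = 0" "?M x = 0"
      using det unfolding 0 by simp_all
    then have "x + v = 0" "x + v ^ 2 = 0"
      by (simp_all only: power_eq_0_iff)
    then show False
      using v by (metis add_left_cancel)
  qed
  have g: "b x * ?g x = x ^ n * b x ^ q" if x: "x \<in> \<mu>" for x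
  proof -
    obtain i j where ij: "r + (q + 1) * i = n + (q + 1) * j"
      using r by (metis cong_iff_lin_nat mult.commute)
    have "x ^ (r + (q + 1) * i) = x ^ (n + (q + 1) * j)"
      by (simp only: ij)
    then have "x ^ r = x ^ n"
      using x by (simp only: power_add[of x r] power_add[of x n] power_mult unity_roots_iff power_one mult_1_right)
    then show ?thesis
      using q_gt_1 by (simp add: mult.left_commute flip: power_Suc)
  qed
  have "?g x = ?g y \<longleftrightarrow> ?P x * ?M y = ?P y * ?M x" if xy: "x \<in> \<mu>" "y \<in> \<mu>" for x y
  proof -
    have "?g x = ?g y \<longleftrightarrow> (\<kappa> * b x) * (\<kappa> * b y) * ?g x = (\<kappa> * b x) * (\<kappa> * b y) * ?g y"
      using \<open>\<kappa> \<noteq> 0\<close> nz xy by simp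
    also have "(\<kappa> * b x) * (\<kappa> * b y) * ?g x = (\<kappa> * b y) * (\<kappa> * (b x * ?g x))"
      by (simp only: mult_ac)
    also have "(\<kappa> * b x) * (\<kappa> * b y) * ?g y = (\<kappa> * b x) * (\<kappa> * (b y * ?g y))"
      by (simp only: mult_ac)
    also have "(\<kappa> * b y) * (\<kappa> * (b x * ?g x)) = (\<kappa> * b x) * (\<kappa> * (b y * ?g y)) \<longleftrightarrow>
        (c1 * ?P y + c2 * ?M y) * (d1 * ?P x + d2 * ?M x) =
        (c1 * ?P x + c2 * ?M x) * (d1 * ?P y + d2 * ?M y)"
      using xy by (simp only: g den num)
    also have "\<dots> \<longleftrightarrow> (c1 * d2 - c2 * d1) * (?P y * ?M x - ?P x * ?M y) = 0"
    proof -
      have "(c1 * ?P y + c2 * ?M y) * (d1 * ?P x + d2 * ?M x) -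
          (c1 * ?P x + c2 * ?M x) * (d1 * ?P y + d2 * ?M y) =
          (c1 * d2 - c2 * d1) * (?P y * ?M x - ?P x * ?M y)"
        by algebra
      then show ?thesis
        by (metis right_minus_eq)
    qed
    finally show ?thesis
      using det by auto
  qed
  then show "inj_on ?g \<mu> \<longleftrightarrow> cross_injective v n"
    by (simp add: inj_on_def cross_injective_def power_mult_distrib)
qed

text \<open>So 1 can serve as the base point of the cross ratio.\<close>
lemma one_plus_cube_root_nonzero:
  fixes v :: 'a
  assumes "v ^ 2 + v + 1 = 0"
  shows "1 + v \<noteq> 0" and "1 + v ^ 2 \<noteq> 0"
proof -
  have "- v * (1 + v) = 1" "- (v ^ 2) * (1 + v ^ 2) = 1"
    using assms by algebra+
  then show "1 + v \<noteq> 0" "1 + v ^ 2 \<noteq> 0"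
    by auto
qed

lemma cross_eq_iff:
  fixes x y v :: 'a
  assumes "v ^ 2 \<noteq> v"
  shows "(x + v) * (y + v ^ 2) = (y + v) * (x + v ^ 2) \<longleftrightarrow> x = y"
proof -
  have "(x + v) * (y + v ^ 2) = (y + v) * (x + v ^ 2) \<longleftrightarrow> (v ^ 2 - v) * (x - y) = 0"
    by algebra
  then show ?thesis
    using assms by simp
qed

lemma cross_ratio_eq_imp_eq:
  fixes x y v :: 'a
  assumes "v ^ 2 \<noteq> v" and "y + v \<noteq> 0" "y + v ^ 2 \<noteq> 0" "x + v ^ 2 \<noteq> 0" "x' + v ^ 2 \<noteq> 0"
    and "(x + v) * (y + v ^ 2) / ((y + v) * (x + v ^ 2)) =
         (x' + v) * (y + v ^ 2) / ((y + v) * (x' + v ^ 2))"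
  shows "x = x'"
proof -
  have "(y + v) * (x + v ^ 2) \<noteq> 0" "(y + v) * (x' + v ^ 2) \<noteq> 0"
    using assms(2-5) by simp_all
  from iffD1[OF frac_eq_eq[OF this] assms(6)]
  have "((y + v ^ 2) * (y + v)) * ((x + v) * (x' + v ^ 2)) =
        ((y + v ^ 2) * (y + v)) * ((x' + v) * (x + v ^ 2))"
    by (simp only: mult_ac)
  then have "(x + v) * (x' + v ^ 2) = (x' + v) * (x + v ^ 2)"
    using assms(2,3) by simp
  then show ?thesis
    using cross_eq_iff[OF assms(1)] by simp
qed

text \<open>
  With the base point 1, every \<open>d\<close>-th root of unity is a ratio \<open>u x / u 1\<close>. A nontrivial one whose
  \<open>n\<close>-th power is 1 then gives \<open>x \<noteq> 1\<close> with the same \<open>n\<close>-th powers.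
\<close>
lemma coprime_if_cross_injective:
  fixes v :: 'a
  assumes v: "v ^ 2 + v + 1 = 0" "v ^ 2 \<noteq> v"
    and d: "d dvd card (UNIV :: 'a set) - 1"
    and surj: "unity_roots d \<subseteq>
      (\<lambda>x. (x + v) * (1 + v ^ 2) / ((1 + v) * (x + v ^ 2))) ` {x \<in> \<mu>. x + v ^ 2 \<noteq> 0}"
    and inj: "cross_injective v n"
  shows "gcd n d = 1"
proof (rule ccontr)
  assume "gcd n d \<noteq> 1"
  then obtain z :: 'a where z: "z \<noteq> 1" "z ^ n = 1" "z ^ d = 1"
    using nontrivial_common_unity_root d by blast
  then have "z \<in> unity_roots d"
    by (simp add: unity_roots_iff)
  with surj obtain x where x: "x \<in> \<mu>" "x + v ^ 2 \<noteq> 0"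
      "z = (x + v) * (1 + v ^ 2) / ((1 + v) * (x + v ^ 2))"
    by blast
  have nz: "(1 + v) * (x + v ^ 2) \<noteq> 0"
    using one_plus_cube_root_nonzero[OF v(1)] x(2) by simp
  then have eq: "(x + v) * (1 + v ^ 2) = z * ((1 + v) * (x + v ^ 2))"
    using x(3) by (simp only: nonzero_eq_divide_eq[OF nz])
  then have "((x + v) * (1 + v ^ 2)) ^ n = ((1 + v) * (x + v ^ 2)) ^ n"
    using z(2) by (simp only: power_mult_distrib[of z] mult_1_left)
  moreover have "1 \<in> \<mu>"
    by (simp add: unity_roots_iff)
  ultimately have "x = 1"
    using inj x(1) unfolding cross_injective_def by blast
  then show False
    using eq nz z(1) by (metis mult_cancel_right1)
qed

text \<open>
  If the ratios \<open>u x / u y\<close> are \<open>d\<close>-th roots of unity, then \<open>n\<close>-th powers separate them. The values zero and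
  infinity of \<open>u\<close> have to be compared separately.
\<close>
lemma cross_injective_if_coprime:
  fixes v :: 'a
  assumes v: "v ^ 2 \<noteq> v" and "gcd n d = 1" and "n > 0"
    and ratio: "\<And>x y. x \<in> \<mu> \<Longrightarrow> y \<in> \<mu> \<Longrightarrow>
      (x + v) * (y + v ^ 2) \<noteq> 0 \<Longrightarrow> (y + v) * (x + v ^ 2) \<noteq> 0 \<Longrightarrow>
      ((x + v) * (y + v ^ 2) / ((y + v) * (x + v ^ 2))) ^ d = 1"
  shows "cross_injective v n"
  unfolding cross_injective_def
proof (intro ballI impI)
  fix x y :: 'a
  define X Y where "X = (x + v) * (y + v ^ 2)" and "Y = (y + v) * (x + v ^ 2)"
  assume xy: "x \<in> \<mu>" "y \<in> \<mu>"
    and "((x + v) * (y + v ^ 2)) ^ n = ((y + v) * (x + v ^ 2)) ^ n"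
  then have eq: "X ^ n = Y ^ n"
    by (simp only: X_def Y_def)
  have "X = 0 \<longleftrightarrow> X ^ n = 0" "Y = 0 \<longleftrightarrow> Y ^ n = 0"
    using \<open>n > 0\<close> by simp_all
  then have zero_iff: "X = 0 \<longleftrightarrow> Y = 0"
    by (simp only: eq)
  have "X = Y"
  proof (cases "Y = 0")
    case True
    then show ?thesis
      using zero_iff by simp
  next
    case False
    then have "X \<noteq> 0"
      by (simp only: zero_iff not_False_eq_True)
    then have "(X / Y) ^ d = 1"
      using False unfolding X_def Y_def by (rule ratio[OF xy])
    moreover have "(X / Y) ^ n = 1"
      using eq False by (simp add: power_divide)
    ultimately have "X / Y = 1"
      using coprime_unity_root_eq_1[OF \<open>gcd n d = 1\<close>, of "X / Y"] by simp
    then show ?thesis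
      using False by simp
  qed
  then show "x = y"
    by (simp only: X_def Y_def cross_eq_iff[OF v])
qed

text \<open>As \<open>x ^ q\<close> is the inverse of \<open>x\<close>, the \<open>q\<close>-power map acts on the linear factors as follows.\<close>
lemma mu_times_conj:
  assumes v: "v ^ 2 + v + 1 = 0" and x: "x \<in> \<mu>"
  shows "x * (x ^ q + v) = v * (x + v ^ 2)" "x * (x ^ q + v ^ 2) = v ^ 2 * (x + v)"
proof -
  have "v * v ^ 2 = 1"
    using v by algebra
  then show "x * (x ^ q + v) = v * (x + v ^ 2)" "x * (x ^ q + v ^ 2) = v ^ 2 * (x + v)"
    using mu_power_q[OF x] unfolding distrib_left mult.commute[of x v] mult.commute[of x "v ^ 2"]
    by (simp_all add: power2_eq_square mult.assoc)
qed

text \<open>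
  Here the \<open>q\<close>-power map inverts the ratios \<open>u x / u y\<close>, so they lie in \<open>\<mu>\<close>. For fixed \<open>y\<close> they exhaust
  \<open>\<mu>\<close>, by injectivity of \<open>u\<close>. No element of \<open>\<mu>\<close> is a zero or a pole of \<open>u\<close>.
\<close>
lemma cross_injective_iff_root_fixed:
  fixes v :: 'a
  assumes v: "v ^ 2 + v + 1 = 0" "v ^ 2 \<noteq> v" "v ^ q = v" and "n > 0"
  shows "cross_injective v n \<longleftrightarrow> gcd n (q + 1) = 1"
proof -
  let ?u = "\<lambda>x y. (x + v) * (y + v ^ 2) / ((y + v) * (x + v ^ 2))"
  have v3: "v * v ^ 2 = 1"
    using v(1) by algebra
  have conj: "x * y * ((x + v) * (y + v ^ 2)) ^ q = (y + v) * (x + v ^ 2)"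
    if "x \<in> \<mu>" "y \<in> \<mu>" for x y
  proof -
    have "((x + v) * (y + v ^ 2)) ^ q = (x ^ q + v) * (y ^ q + v ^ 2)"
      using v(3) by (simp add: power_mult_distrib frobenius_q power2_eq_square)
    then have "x * y * ((x + v) * (y + v ^ 2)) ^ q = (x * (x ^ q + v)) * (y * (y ^ q + v ^ 2))"
      by (simp only: mult_ac)
    also have "\<dots> = (v * (x + v ^ 2)) * (v ^ 2 * (y + v))"
      using mu_times_conj[OF v(1)] that by simp
    also have "\<dots> = (v * v ^ 2) * ((y + v) * (x + v ^ 2))"
      by (simp only: mult_ac)
    finally show ?thesis
      by (simp only: v3 mult_1_left)
  qed
  have nz: "x + v \<noteq> 0" "x + v ^ 2 \<noteq> 0" if "x \<in> \<mu>" for x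
  proof -
    have "x \<noteq> - v \<and> x \<noteq> - (v ^ 2)"
    proof (intro conjI notI)
      assume "x = - v"
      then have "v * v = 1"
        using mu_power_q[OF that] frobenius_minus[of v k, folded q_def] v(3) by simp
      moreover have "v ^ 2 * v = 1"
        using v(1) by algebra
      ultimately show False
        using v(2) by (simp add: power2_eq_square)
    next
      assume "x = - (v ^ 2)"
      moreover have "(- (v ^ 2)) ^ q = - (v ^ 2)"
        using frobenius_minus[of "v ^ 2" k, folded q_def] v(3)
        by (simp add: power_mult_distrib power2_eq_square)
      ultimately have "v ^ 2 * v ^ 2 = 1"
        using mu_power_q[OF that] by simp
      moreover have "v ^ 2 * v ^ 2 = v"
        using v(1) by algebra
      ultimately show False
        using v(2) by simp
    qed
    then show "x + v \<noteq> 0" "x + v ^ 2 \<noteq> 0"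
      by (auto simp: add_eq_0_iff2)
  qed
  have u: "?u x y ^ (q + 1) = 1" if xy: "x \<in> \<mu>" "y \<in> \<mu>" for x y
  proof -
    let ?X = "(x + v) * (y + v ^ 2)" and ?Y = "(y + v) * (x + v ^ 2)"
    have ne: "x * y \<noteq> 0" "?X \<noteq> 0" "?Y \<noteq> 0"
      using nz xy mu_nonzero by simp_all
    have "x * y * ?X ^ q = ?Y" "x * y * ?Y ^ q = ?X"
      using conj[OF xy] conj[OF xy(2,1)] by (simp_all only: mult.commute[of y x])
    then have "(x * y * ?X ^ q) * ?X = (x * y * ?Y ^ q) * ?Y"
      by (simp only: mult.commute[of ?X ?Y])
    then have "(x * y) * (?X ^ q * ?X) = (x * y) * (?Y ^ q * ?Y)"
      by (simp only: mult.assoc)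
    then have "?X ^ q * ?X = ?Y ^ q * ?Y"
      using ne(1) by simp
    then have "?X ^ (q + 1) = ?Y ^ (q + 1)"
      by (simp only: Suc_eq_plus1[symmetric] power_Suc2)
    moreover have "?Y ^ (q + 1) \<noteq> 0"
      using ne(3) by (rule power_not_zero)
    ultimately show ?thesis
      by (simp only: power_divide divide_self_if if_False)
  qed
  have one: "(1 :: 'a) \<in> \<mu>"
    by (simp add: unity_roots_iff)
  have "(\<lambda>x. ?u x 1) ` \<mu> = \<mu>"
  proof (rule card_subset_eq)
    show "(\<lambda>x. ?u x 1) ` \<mu> \<subseteq> \<mu>"
      using u[OF _ one] by (intro image_subsetI) (simp add: unity_roots_iff del: power_Suc)
    have "inj_on (\<lambda>x. ?u x 1) \<mu>"
      using nz one by (intro inj_onI) (rule cross_ratio_eq_imp_eq[OF v(2)], simp_all)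
    then show "card ((\<lambda>x. ?u x 1) ` \<mu>) = card \<mu>"
      by (rule card_image)
  qed simp
  moreover have "{x \<in> \<mu>. x + v ^ 2 \<noteq> 0} = \<mu>"
    using nz by blast
  ultimately have surj: "\<mu> \<subseteq> (\<lambda>x. ?u x 1) ` {x \<in> \<mu>. x + v ^ 2 \<noteq> 0}"
    by simp
  show ?thesis
  proof
    show "gcd n (q + 1) = 1" if "cross_injective v n"
      using coprime_if_cross_injective[OF v(1,2) _ surj that] dvd_card_minus_1(1) by blast
    show "cross_injective v n" if "gcd n (q + 1) = 1"
      using cross_injective_if_coprime[OF v(2) that \<open>n > 0\<close> u] .
  qed
qed

text \<open>
  Here the ratios \<open>u x / u y\<close> are fixed by the \<open>q\<close>-power map, so they lie in the subfield with \<open>q\<close>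
  elements. One element of \<open>\<mu>\<close> is a pole of \<open>u\<close>; the other \<open>q\<close> elements give every value in
  the subfield once.
\<close>
lemma cross_injective_iff_root_conjugated:
  fixes v :: 'a
  assumes v: "v ^ 2 + v + 1 = 0" "v ^ 2 \<noteq> v" "v ^ q = v ^ 2" and "n > 0"
  shows "cross_injective v n \<longleftrightarrow> gcd n (q - 1) = 1"
proof -
  let ?u = "\<lambda>x y. (x + v) * (y + v ^ 2) / ((y + v) * (x + v ^ 2))"
  have v3: "v * v ^ 2 = 1"
    using v(1) by algebra
  have conj: "x * y * ((x + v) * (y + v ^ 2)) ^ q = (x + v) * (y + v ^ 2)"
    if "x \<in> \<mu>" "y \<in> \<mu>" for x y
  proof -
    have "v ^ 2 * v ^ 2 = v"
      using v(1) by algebra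
    then have "(v ^ 2) ^ q = v"
      using v(3) by (simp add: power_mult_distrib power2_eq_square)
    then have "((x + v) * (y + v ^ 2)) ^ q = (x ^ q + v ^ 2) * (y ^ q + v)"
      using v(3) by (simp add: power_mult_distrib frobenius_q)
    then have "x * y * ((x + v) * (y + v ^ 2)) ^ q = (x * (x ^ q + v ^ 2)) * (y * (y ^ q + v))"
      by (simp only: mult_ac)
    also have "\<dots> = (v ^ 2 * (x + v)) * (v * (y + v ^ 2))"
      using mu_times_conj[OF v(1)] that by simp
    also have "\<dots> = (v * v ^ 2) * ((x + v) * (y + v ^ 2))"
      by (simp only: mult_ac)
    finally show ?thesis
      by (simp only: v3 mult_1_left)
  qed
  have u: "?u x y ^ q = ?u x y" if xy: "x \<in> \<mu>" "y \<in> \<mu>" for x y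
  proof -
    let ?X = "(x + v) * (y + v ^ 2)" and ?Y = "(y + v) * (x + v ^ 2)"
    have "x * y \<noteq> 0"
      using xy mu_nonzero by simp
    moreover have "x * y * ?X ^ q = ?X" "x * y * ?Y ^ q = ?Y"
      using conj[OF xy] conj[OF xy(2,1)] by (simp_all only: mult.commute[of y x])
    ultimately have "?X ^ q / ?Y ^ q = ?X / ?Y"
      by (metis mult_divide_mult_cancel_left)
    then show ?thesis
      by (simp only: power_divide)
  qed
  have u': "?u x y ^ (q - 1) = 1" if xy: "x \<in> \<mu>" "y \<in> \<mu>"
      and "(x + v) * (y + v ^ 2) \<noteq> 0" "(y + v) * (x + v ^ 2) \<noteq> 0" for x y
  proof -
    define z where "z = ?u x y"
    have "z \<noteq> 0"
      using that by (simp add: z_def)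
    moreover have "z ^ (q - 1) * z = z"
      using u[OF xy] q_gt_1 power_minus_mult[of q z] by (simp only: z_def)
    ultimately show ?thesis
      by (simp add: z_def)
  qed
  let ?A = "{x \<in> \<mu>. x + v ^ 2 \<noteq> 0}"
  have one: "1 \<in> \<mu>" "1 + v \<noteq> 0" "1 + v ^ 2 \<noteq> 0"
    using one_plus_cube_root_nonzero[OF v(1)] by (simp_all add: unity_roots_iff)
  have card_A: "q \<le> card ?A"
  proof -
    have "card (\<mu> - {- (v ^ 2)}) \<le> card ?A"
      by (intro card_mono) (auto simp: add_eq_0_iff2)
    then show ?thesis
      using card_mu diff_card_le_card_Diff[of "{- (v ^ 2)}" \<mu>] by simp
  qed
  have "(\<lambda>x. ?u x 1) ` ?A = insert 0 (unity_roots (q - 1))"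
  proof (rule card_seteq)
    show "(\<lambda>x. ?u x 1) ` ?A \<subseteq> insert 0 (unity_roots (q - 1))"
    proof (rule image_subsetI)
      fix x assume "x \<in> ?A"
      then show "?u x 1 \<in> insert 0 (unity_roots (q - 1))"
        using u'[of x 1] one by (cases "x + v = 0") (auto simp: unity_roots_iff)
    qed
    have "inj_on (\<lambda>x. ?u x 1) ?A"
      using one by (intro inj_onI) (rule cross_ratio_eq_imp_eq[OF v(2)], simp_all)
    then have "q \<le> card ((\<lambda>x. ?u x 1) ` ?A)"
      using card_A by (simp add: card_image)
    moreover have "card (insert 0 (unity_roots (q - 1)) :: 'a set) \<le> q"
    proof -
      have "card (unity_roots (q - 1) :: 'a set) = q - 1"
        using power_image_unity_roots(2)[where 'a = 'a, of "q - 1" "q + 1"] card_minus_1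
        by (simp add: mult.commute)
      then show ?thesis
        using q_gt_1 by (simp add: card_insert_if)
    qed
    ultimately show "card (insert 0 (unity_roots (q - 1)) :: 'a set) \<le> card ((\<lambda>x. ?u x 1) ` ?A)"
      by simp
  qed simp
  then have surj: "unity_roots (q - 1) \<subseteq> (\<lambda>x. ?u x 1) ` ?A"
    by (simp only: subset_insertI)
  show ?thesis
  proof
    show "gcd n (q - 1) = 1" if "cross_injective v n"
      using coprime_if_cross_injective[OF v(1,2) _ surj that] dvd_card_minus_1(2) by blast
    show "cross_injective v n" if "gcd n (q - 1) = 1"
      using cross_injective_if_coprime[OF v(2) that \<open>n > 0\<close> u'] .
  qed
qed

lemma q_mod_3:
  assumes "p \<noteq> 3"
  shows "q mod 3 = 1 \<or> q mod 3 = 2"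
proof -
  have "prime (3 :: nat)"
    by simp
  then have "\<not> 3 dvd q"
    using prime_p assms q_def by (metis prime_dvd_power primes_dvd_imp_eq)
  then show ?thesis
    by presburger
qed

text \<open>The condition \<open>v\<^sup>2 \<noteq> v\<close> records that the two primitive cube roots of unity are distinct.\<close>
lemma obtain_cube_root_of_unity:
  assumes "p \<noteq> 3"
  obtains v :: 'a where "v ^ 2 + v + 1 = 0" "v ^ 2 \<noteq> v"
proof -
  have "3 dvd (q + 1) * (q - 1)"
  proof (cases "q mod 3 = 1")
    case True
    then have "3 dvd q - 1"
      by (metis dvd_minus_mod)
    then show ?thesis
      by (rule dvd_mult)
  next
    case False
    then have "(q + 1) mod 3 = 0"
      using q_mod_3[OF assms] by (simp add: mod_Suc)
    then have "3 dvd q + 1"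
      by (simp only: mod_eq_0_iff_dvd)
    then show ?thesis
      by (rule dvd_mult2)
  qed
  then have "3 dvd card (UNIV :: 'a set) - 1"
    by (simp only: card_minus_1)
  then obtain v :: 'a where v: "v \<noteq> 1" "v ^ 3 = 1"
    by (rule nontrivial_common_unity_root[of 3 3]) simp_all
  have "(v - 1) * (v ^ 2 + v + 1) = v ^ 3 - 1"
    by (simp add: algebra_simps power2_eq_square power3_eq_cube)
  then have "v ^ 2 + v + 1 = 0"
    using v by simp
  moreover have "v ^ 2 \<noteq> v"
  proof
    assume "v ^ 2 = v"
    then have "v ^ 3 = v"
      by (simp only: power3_eq_cube power2_eq_square)
    then show False
      using v by simp
  qed
  ultimately show ?thesis
    by (rule that)
qed

lemma cube_root_power_cong:
  fixes v :: 'a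
  assumes v: "v ^ 2 + v + 1 = 0" and "[m = n] (mod 3)"
  shows "v ^ m = v ^ n"
proof -
  have v3: "v ^ 3 = 1"
    using v by algebra
  have "v ^ j = v ^ (j mod 3)" for j
  proof -
    have "v ^ (3 * (j div 3) + j mod 3) = v ^ (j mod 3)"
      by (simp only: power_add power_mult v3 power_one mult_1_left)
    then show ?thesis
      by (simp only: mult_div_mod_eq)
  qed
  from this[of m] this[of n] show ?thesis
    using \<open>[m = n] (mod 3)\<close> by (simp only: cong_def)
qed

lemma cross_injective_iff:
  fixes v :: 'a
  assumes "p \<noteq> 3" and v: "v ^ 2 + v + 1 = 0" "v ^ 2 \<noteq> v" and "n > 0"
  shows "cross_injective v n \<longleftrightarrow>
           ([int q = 1] (mod 3) \<and> gcd n (q + 1) = 1) \<or> ([int q = -1] (mod 3) \<and> gcd n (q - 1) = 1)"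
proof -
  have int_q: "int q mod 3 = int (q mod 3)"
    using zmod_int[of q 3] by (simp only: of_nat_numeral)
  consider "q mod 3 = 1" | "q mod 3 = 2"
    using q_mod_3[OF \<open>p \<noteq> 3\<close>] by blast
  then show ?thesis
  proof cases
    case 1
    then have cong: "[int q = 1] (mod 3)" "\<not> [int q = -1] (mod 3)" "[q = 1] (mod 3)"
      using int_q by (simp_all add: cong_def)
    from cube_root_power_cong[OF v(1) this(3)] have "v ^ q = v"
      by (simp only: power_one_right)
    from cross_injective_iff_root_fixed[OF v this \<open>n > 0\<close>] show ?thesis
      using cong by (simp only: simp_thms)
  next
    case 2
    then have cong: "[int q = -1] (mod 3)" "\<not> [int q = 1] (mod 3)" "[q = 2] (mod 3)"
      using int_q by (simp_all add: cong_def)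
    from cross_injective_iff_root_conjugated[OF v cube_root_power_cong[OF v(1) this(3)] \<open>n > 0\<close>]
    show ?thesis
      using cong by (simp only: simp_thms)
  qed
qed

section \<open>The four pentanomials\<close>

lemma power_shift_frobenius:
  fixes x v :: 'a
  assumes "\<exists>i. Q = p ^ i" "\<exists>i. R = p ^ i" "\<exists>i. S = p ^ i"
  shows "(x + v) ^ (Q + R + S) = (x ^ Q + v ^ Q) * (x ^ R + v ^ R) * (x ^ S + v ^ S)"
  using assms by (auto simp: power_add frobenius)

lemma frobenius_cube_root:
  fixes v :: 'a
  assumes "v ^ 2 + v + 1 = 0" and "\<exists>i. Q = p ^ i"
  shows "(v ^ Q) ^ 2 + v ^ Q + 1 = 0"
proof -
  obtain i where Q: "Q = p ^ i"
    using assms(2) by blast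
  have "(v ^ Q) ^ 2 + v ^ Q + 1 = (v ^ 2 + v + 1) ^ Q"
    by (simp add: Q frobenius mult.commute flip: power_mult)
  then show ?thesis
    using assms(1) prime_gt_0_nat[OF prime_p] by (simp add: Q)
qed

text \<open>
  The common scaling factor and the determinant of the Moebius transformations below; both divide 3, so they
  vanish only in characteristic 3.
\<close>
lemma cube_root_minus_1_nonzero:
  fixes w :: 'a
  assumes "p \<noteq> 3" and "w ^ 2 + w + 1 = 0"
  shows "1 - w \<noteq> 0" and "w ^ 2 - 1 \<noteq> 0"
proof -
  have "\<not> CHAR('a) dvd 3"
    using prime_p \<open>p \<noteq> 3\<close> primes_dvd_imp_eq[of p 3] by (auto simp: CHAR_eq_p)
  then have "of_nat 3 \<noteq> (0 :: 'a)"
    by (simp only: of_nat_eq_0_iff_char_dvd not_False_eq_True)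
  moreover have "(1 - w) * (2 + w) = 3" "(w ^ 2 - 1) * (w - 1) = 3"
    using assms(2) by algebra+
  ultimately show "1 - w \<noteq> 0" "w ^ 2 - 1 \<noteq> 0"
    by auto
qed

lemma inverse_powers_on_mu:
  assumes "x \<in> \<mu>"
  shows "x ^ m * (x ^ m) ^ q = 1"
proof -
  have "x ^ m * (x ^ m) ^ q = (x * x ^ q) ^ m"
    by (simp add: power_mult_distrib mult.commute flip: power_mult)
  then show ?thesis
    by (simp add: mu_power_q[OF assms])
qed

text \<open>
  With \<open>a\<close>, \<open>b\<close>, \<open>c\<close> standing for \<open>x ^ Q\<close>, \<open>x ^ R\<close>, \<open>x ^ S\<close> and \<open>a'\<close>, \<open>b'\<close>, \<open>c'\<close> for their
  inverses, the coefficients on the right come from solving a linear system: the coefficients of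
  \<open>a * b * c + 1\<close>, \<open>a * b + a * c + b * c\<close> and \<open>a + b + c\<close> in the first product are \<open>1\<close>, \<open>w\<close>, \<open>w\<^sup>2\<close>,
  and in the second \<open>1\<close>, \<open>w\<^sup>2\<close>, \<open>w\<close>.
\<close>
lemma moebius_identity_symmetric:
  fixes w a b c a' b' c' :: 'a
  assumes w: "w ^ 2 + w + 1 = 0"
  shows "(1 - w) * (a * b * c - a - b - c + 1) =
      - w * ((a + w) * (b + w) * (c + w)) + 1 * ((a + w ^ 2) * (b + w ^ 2) * (c + w ^ 2))"
    and "a * a' = 1 \<Longrightarrow> b * b' = 1 \<Longrightarrow> c * c' = 1 \<Longrightarrow>
      (1 - w) * (a * b * c * (a' * b' * c' - a' - b' - c' + 1)) =
      1 * ((a + w) * (b + w) * (c + w)) + - w * ((a + w ^ 2) * (b + w ^ 2) * (c + w ^ 2))"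
proof -
  show "(1 - w) * (a * b * c - a - b - c + 1) =
      - w * ((a + w) * (b + w) * (c + w)) + 1 * ((a + w ^ 2) * (b + w ^ 2) * (c + w ^ 2))"
    using w by algebra
next
  assume inv: "a * a' = 1" "b * b' = 1" "c * c' = 1"
  have "a * b * c * (a' * b' * c' - a' - b' - c' + 1) =
      (a * a') * (b * b') * (c * c') - (a * a') * b * c - a * (b * b') * c - a * b * (c * c') + a * b * c"
    by algebra
  then have "a * b * c * (a' * b' * c' - a' - b' - c' + 1) = 1 - b * c - a * c - a * b + a * b * c"
    by (simp only: inv mult_1_left mult_1_right)
  moreover have "(1 - w) * (1 - b * c - a * c - a * b + a * b * c) =
      1 * ((a + w) * (b + w) * (c + w)) + - w * ((a + w ^ 2) * (b + w ^ 2) * (c + w ^ 2))"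
    using w by algebra
  ultimately show "(1 - w) * (a * b * c * (a' * b' * c' - a' - b' - c' + 1)) =
      1 * ((a + w) * (b + w) * (c + w)) + - w * ((a + w ^ 2) * (b + w ^ 2) * (c + w ^ 2))"
    by (simp only:)
qed

text \<open>
  The same linear algebra, now with the three groups \<open>a * b * c + a + b\<close>, \<open>a * c + b * c + 1\<close> and
  \<open>a * b + c\<close>, whose coefficients are \<open>1\<close>, \<open>w\<close>, \<open>w\<^sup>2\<close> and \<open>1\<close>, \<open>w\<^sup>2\<close>, \<open>w\<close>.
\<close>
lemma moebius_identity_skew:
  fixes w a b c a' b' c' :: 'a
  assumes w: "w ^ 2 + w + 1 = 0"
  shows "(1 - w) * (a * b - a * c - b * c + c - 1) =
      - (w ^ 2) * ((a + w) * (b + w) * (c + w ^ 2)) + w ^ 2 * ((a + w ^ 2) * (b + w ^ 2) * (c + w))"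
    and "a * a' = 1 \<Longrightarrow> b * b' = 1 \<Longrightarrow> c * c' = 1 \<Longrightarrow>
      (1 - w) * (a * b * c * (a' * b' - a' * c' - b' * c' + c' - 1)) =
      w * ((a + w) * (b + w) * (c + w ^ 2)) + - 1 * ((a + w ^ 2) * (b + w ^ 2) * (c + w))"
proof -
  show "(1 - w) * (a * b - a * c - b * c + c - 1) =
      - (w ^ 2) * ((a + w) * (b + w) * (c + w ^ 2)) + w ^ 2 * ((a + w ^ 2) * (b + w ^ 2) * (c + w))"
    using w by algebra
next
  assume inv: "a * a' = 1" "b * b' = 1" "c * c' = 1"
  have "a * b * c * (a' * b' - a' * c' - b' * c' + c' - 1) =
      (a * a') * (b * b') * c - (a * a') * b * (c * c') - a * (b * b') * (c * c') + a * b * (c * c')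
      - a * b * c"
    by algebra
  then have "a * b * c * (a' * b' - a' * c' - b' * c' + c' - 1) = c - b - a + a * b - a * b * c"
    by (simp only: inv mult_1_left mult_1_right)
  moreover have "(1 - w) * (c - b - a + a * b - a * b * c) =
      w * ((a + w) * (b + w) * (c + w ^ 2)) + - 1 * ((a + w ^ 2) * (b + w ^ 2) * (c + w))"
    using w by algebra
  ultimately show "(1 - w) * (a * b * c * (a' * b' - a' * c' - b' * c' + c' - 1)) =
      w * ((a + w) * (b + w) * (c + w ^ 2)) + - 1 * ((a + w ^ 2) * (b + w ^ 2) * (c + w))"
    by (simp only:)
qed

text \<open>
  The common sign in the congruences decides whether \<open>v ^ Q\<close> is \<open>v\<close> or \<open>v\<^sup>2\<close>. Naming it \<open>w\<close> treats both
  signs at once: only \<open>v ^ R = w\<close> and \<open>v ^ S = w\<close> matter.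
\<close>
lemma symmetric_pentanomial:
  fixes v :: 'a and b :: "'a \<Rightarrow> 'a"
  assumes "p \<noteq> 3" and v: "v ^ 2 + v + 1 = 0" "v ^ 2 \<noteq> v"
    and QRS: "\<exists>i. Q = p ^ i" "\<exists>i. R = p ^ i" "\<exists>i. S = p ^ i" and c3: "cong3_pm Q R S 1 1 1"
    and r: "[r = Q + R + S] (mod (q + 1))"
    and b: "\<And>x. b x = x ^ (Q + R + S) - x ^ Q - x ^ R - x ^ S + 1"
  shows "\<And>x. x \<in> \<mu> \<Longrightarrow> b x \<noteq> 0"
    and "inj_on (\<lambda>x. x ^ r * b x ^ (q - 1)) \<mu> \<longleftrightarrow> cross_injective v (Q + R + S)"
proof -
  define w where "w = v ^ Q"
  have w: "w ^ 2 + w + 1 = 0"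
    unfolding w_def using frobenius_cube_root v(1) QRS(1) .
  have "[int R = int Q] (mod 3)" "[int S = int Q] (mod 3)"
    using c3 unfolding cong3_pm_def by (auto simp: cong_def)
  then have "[R = Q] (mod 3)" "[S = Q] (mod 3)"
    by (simp_all flip: cong_int_iff)
  then have vR: "v ^ R = w" and vS: "v ^ S = w"
    unfolding w_def by (blast intro: cube_root_power_cong[OF v(1)])+
  have P: "(x + v) ^ (Q + R + S) = (x ^ Q + w) * (x ^ R + w) * (x ^ S + w)" for x
    by (simp only: power_shift_frobenius[OF QRS] vR vS w_def)
  have "(v ^ 2) ^ m = (v ^ m) ^ 2" for m
    by (simp add: mult.commute flip: power_mult)
  then have sq: "(v ^ 2) ^ Q = w ^ 2" "(v ^ 2) ^ R = w ^ 2" "(v ^ 2) ^ S = w ^ 2"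
    by (simp_all only: vR vS w_def[symmetric])
  then have M: "(x + v ^ 2) ^ (Q + R + S) = (x ^ Q + w ^ 2) * (x ^ R + w ^ 2) * (x ^ S + w ^ 2)" for x
    by (simp only: power_shift_frobenius[OF QRS])
  have n: "Q + R + S > 0"
    using QRS(1) prime_gt_0_nat[OF prime_p] by auto
  have den: "(1 - w) * b x = - w * (x + v) ^ (Q + R + S) + 1 * (x + v ^ 2) ^ (Q + R + S)" for x
  proof -
    have "(1 - w) * (x ^ Q * x ^ R * x ^ S - x ^ Q - x ^ R - x ^ S + 1) =
        - w * ((x ^ Q + w) * (x ^ R + w) * (x ^ S + w)) +
        1 * ((x ^ Q + w ^ 2) * (x ^ R + w ^ 2) * (x ^ S + w ^ 2))"
      using moebius_identity_symmetric(1)[OF w] .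
    then show ?thesis
      by (simp only: P M b power_add[of x])
  qed
  have num: "(1 - w) * (x ^ (Q + R + S) * b x ^ q) =
      1 * (x + v) ^ (Q + R + S) + - w * (x + v ^ 2) ^ (Q + R + S)" if x: "x \<in> \<mu>" for x
  proof -
    have bq: "b x ^ q = (x ^ Q) ^ q * (x ^ R) ^ q * (x ^ S) ^ q - (x ^ Q) ^ q - (x ^ R) ^ q - (x ^ S) ^ q + 1"
      by (simp add: b frobenius_q frobenius_diff_q power_add power_mult_distrib)
    show ?thesis
      unfolding bq P M power_add[of x "Q + R"] power_add[of x Q]
      by (rule moebius_identity_symmetric(2)[OF w inverse_powers_on_mu inverse_powers_on_mu inverse_powers_on_mu])
        (rule x)+
  qed
  have det: "- w * (- w) \<noteq> 1 * 1"
    using cube_root_minus_1_nonzero(2)[OF \<open>p \<noteq> 3\<close> w] by (simp add: power2_eq_square)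
  show "\<And>x. x \<in> \<mu> \<Longrightarrow> b x \<noteq> 0"
    and "inj_on (\<lambda>x. x ^ r * b x ^ (q - 1)) \<mu> \<longleftrightarrow> cross_injective v (Q + R + S)"
    by (rule moebius_power_inj_iff[OF v(2) n r cube_root_minus_1_nonzero(1)[OF \<open>p \<noteq> 3\<close> w] det den num]; assumption)+
qed

text \<open>
  On \<open>\<mu>\<close> this is \<open>x ^ S\<close> times the symmetric polynomial with \<open>S\<close> replaced by \<open>- S\<close>, which explains
  the opposite sign in the congruence: now \<open>v ^ S\<close> is the inverse \<open>w\<^sup>2\<close> of \<open>w\<close>.
\<close>
lemma skew_pentanomial:
  fixes v :: 'a and b :: "'a \<Rightarrow> 'a"
  assumes "p \<noteq> 3" and v: "v ^ 2 + v + 1 = 0" "v ^ 2 \<noteq> v"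
    and QRS: "\<exists>i. Q = p ^ i" "\<exists>i. R = p ^ i" "\<exists>i. S = p ^ i" and c3: "cong3_pm Q R S 1 1 (-1)"
    and r: "[r = Q + R + S] (mod (q + 1))"
    and b: "\<And>x. b x = x ^ (Q + R) - x ^ (Q + S) - x ^ (R + S) + x ^ S - 1"
  shows "\<And>x. x \<in> \<mu> \<Longrightarrow> b x \<noteq> 0"
    and "inj_on (\<lambda>x. x ^ r * b x ^ (q - 1)) \<mu> \<longleftrightarrow> cross_injective v (Q + R + S)"
proof -
  define w where "w = v ^ Q"
  have w: "w ^ 2 + w + 1 = 0"
    unfolding w_def using frobenius_cube_root v(1) QRS(1) .
  have "[int R = int Q] (mod 3)" "[int S = int (Q * 2)] (mod 3)"
    using c3 unfolding cong3_pm_def by (auto simp: cong_def) presburger+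
  then have "[R = Q] (mod 3)" "[S = Q * 2] (mod 3)"
    by (simp_all flip: cong_int_iff)
  then have vR: "v ^ R = w" and vS: "v ^ S = w ^ 2"
    unfolding w_def power_mult[symmetric] by (blast intro: cube_root_power_cong[OF v(1)])+
  have P: "(x + v) ^ (Q + R + S) = (x ^ Q + w) * (x ^ R + w) * (x ^ S + w ^ 2)" for x
    by (simp only: power_shift_frobenius[OF QRS] vR vS w_def)
  have w4: "(w ^ 2) ^ 2 = w"
    using w by algebra
  have "(v ^ 2) ^ m = (v ^ m) ^ 2" for m
    by (simp add: mult.commute flip: power_mult)
  then have sq: "(v ^ 2) ^ Q = w ^ 2" "(v ^ 2) ^ R = w ^ 2" "(v ^ 2) ^ S = w"
    by (simp_all only: vR vS w_def[symmetric] w4)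
  then have M: "(x + v ^ 2) ^ (Q + R + S) = (x ^ Q + w ^ 2) * (x ^ R + w ^ 2) * (x ^ S + w)" for x
    by (simp only: power_shift_frobenius[OF QRS])
  have n: "Q + R + S > 0"
    using QRS(1) prime_gt_0_nat[OF prime_p] by auto
  have den: "(1 - w) * b x = - (w ^ 2) * (x + v) ^ (Q + R + S) + w ^ 2 * (x + v ^ 2) ^ (Q + R + S)" for x
  proof -
    have "(1 - w) * (x ^ Q * x ^ R - x ^ Q * x ^ S - x ^ R * x ^ S + x ^ S - 1) =
        - (w ^ 2) * ((x ^ Q + w) * (x ^ R + w) * (x ^ S + w ^ 2)) +
        w ^ 2 * ((x ^ Q + w ^ 2) * (x ^ R + w ^ 2) * (x ^ S + w))"
      using moebius_identity_skew(1)[OF w] .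
    then show ?thesis
      by (simp only: P M b power_add[of x])
  qed
  have num: "(1 - w) * (x ^ (Q + R + S) * b x ^ q) =
      w * (x + v) ^ (Q + R + S) + - 1 * (x + v ^ 2) ^ (Q + R + S)" if x: "x \<in> \<mu>" for x
  proof -
    have bq: "b x ^ q = (x ^ Q) ^ q * (x ^ R) ^ q - (x ^ Q) ^ q * (x ^ S) ^ q - (x ^ R) ^ q * (x ^ S) ^ q
        + (x ^ S) ^ q - 1"
      by (simp add: b frobenius_q frobenius_diff_q power_add power_mult_distrib)
    show ?thesis
      unfolding bq P M power_add[of x "Q + R"] power_add[of x Q]
      by (rule moebius_identity_skew(2)[OF w inverse_powers_on_mu inverse_powers_on_mu inverse_powers_on_mu])
        (rule x)+
  qed
  have "w * w ^ 2 = 1"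
    using w by algebra
  then have det: "- (w ^ 2) * - 1 \<noteq> w ^ 2 * w"
    using cube_root_minus_1_nonzero(2)[OF \<open>p \<noteq> 3\<close> w] by (simp add: mult.commute)
  show "\<And>x. x \<in> \<mu> \<Longrightarrow> b x \<noteq> 0"
    and "inj_on (\<lambda>x. x ^ r * b x ^ (q - 1)) \<mu> \<longleftrightarrow> cross_injective v (Q + R + S)"
    by (rule moebius_power_inj_iff[OF v(2) n r cube_root_minus_1_nonzero(1)[OF \<open>p \<noteq> 3\<close> w] det den num]; assumption)+
qed

end

theorem corollary1p7:
  fixes p k q Q R S r :: nat
    and B f :: "'a::{field,finite} poly"
  assumes "prime p" and "p \<noteq> 3" and "k > 0" and "q = p ^ k"
    and "card (UNIV :: 'a set) = q ^ 2"
    and "\<exists>i. Q = p ^ i" and "\<exists>i. R = p ^ i" and "\<exists>i. S = p ^ i"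
    and "r > 0" and "[r = Q + R + S] (mod (q + 1))"
    and "(B = monom 1 (Q + R + S) - monom 1 Q - monom 1 R - monom 1 S + 1
            \<and> cong3_pm Q R S 1 1 1)
       \<or> (B = monom 1 (Q + R + S) - monom 1 Q - monom 1 R - monom 1 S - 1
            \<and> cong3_pm Q R S 1 1 1)
       \<or> (B = monom 1 (Q + R) - monom 1 (Q + S) - monom 1 (R + S) + monom 1 S - 1
            \<and> cong3_pm Q R S 1 1 (-1))
       \<or> (B = monom 1 (Q + R) - monom 1 (Q + S) - monom 1 (R + S) - monom 1 S - 1
            \<and> cong3_pm Q R S 1 1 (-1))"
    and "f = monom 1 r * pcompose B (monom 1 (q - 1))"
  shows "permutation_poly f \<longleftrightarrow>
           gcd r (q - 1) = 1 \<and>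
           (([int q = 1] (mod 3) \<and> gcd (Q + R + S) (q + 1) = 1) \<or>
            ([int q = -1] (mod 3) \<and> gcd (Q + R + S) (q - 1) = 1))"
proof -
  interpret quadratic_finite_field p k q "TYPE('a)"
    using assms(1,3-5) by unfold_locales
  note QRS = assms(6-8)
  obtain v :: 'a where v: "v ^ 2 + v + 1 = 0" "v ^ 2 \<noteq> v"
    using obtain_cube_root_of_unity[OF \<open>p \<noteq> 3\<close>] .
  let ?sym = "\<lambda>x :: 'a. x ^ (Q + R + S) - x ^ Q - x ^ R - x ^ S + 1"
  let ?skew = "\<lambda>x :: 'a. x ^ (Q + R) - x ^ (Q + S) - x ^ (R + S) + x ^ S - 1"
  note sym = symmetric_pentanomial[where b = ?sym, OF \<open>p \<noteq> 3\<close> v QRS _ assms(10) refl]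
  note skew = skew_pentanomial[where b = ?skew, OF \<open>p \<noteq> 3\<close> v QRS _ assms(10) refl]
  have one: "(1 :: 'a) \<in> \<mu>"
    by (simp add: unity_roots_iff)
  have minus_one: "(- 1 :: 'a) \<in> \<mu>"
    using frobenius_minus[of 1 k, folded q_def] by (simp add: unity_roots_iff)
  have odd: "(- x) ^ Q = - (x ^ Q)" "(- x) ^ R = - (x ^ R)" "(- x) ^ S = - (x ^ S)" for x :: 'a
    using QRS frobenius_minus by auto
  have "(\<forall>x\<in>\<mu>. poly B x \<noteq> 0) \<and>
      (inj_on (\<lambda>x. x ^ r * poly B x ^ (q - 1)) \<mu> \<longleftrightarrow> cross_injective v (Q + R + S))"
    using assms(11)
  proof (elim disjE conjE)
    assume B: "B = monom 1 (Q + R + S) - monom 1 Q - monom 1 R - monom 1 S + 1"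
      and c3: "cong3_pm Q R S 1 1 1"
    have "poly B (1 * x) = 1 * ?sym x" for x
      by (simp add: B poly_monom)
    note scale = mu_scale_iff[where B = "poly B" and b = ?sym, OF one _ this]
    show ?thesis
      using scale(1) scale(2)[of r] sym(1)[OF c3] sym(2)[OF c3] by simp
  next
    assume B: "B = monom 1 (Q + R + S) - monom 1 Q - monom 1 R - monom 1 S - 1"
      and c3: "cong3_pm Q R S 1 1 1"
    have "poly B (- 1 * x) = - 1 * ?sym x" for x
      by (simp add: B poly_monom power_add odd)
    note scale = mu_scale_iff[where B = "poly B" and b = ?sym, OF minus_one _ this]
    show ?thesis
      using scale(1) scale(2)[of r] sym(1)[OF c3] sym(2)[OF c3] by simp
  next
    assume B: "B = monom 1 (Q + R) - monom 1 (Q + S) - monom 1 (R + S) + monom 1 S - 1"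
      and c3: "cong3_pm Q R S 1 1 (- 1)"
    have "poly B (1 * x) = 1 * ?skew x" for x
      by (simp add: B poly_monom)
    note scale = mu_scale_iff[where B = "poly B" and b = ?skew, OF one _ this]
    show ?thesis
      using scale(1) scale(2)[of r] skew(1)[OF c3] skew(2)[OF c3] by simp
  next
    assume B: "B = monom 1 (Q + R) - monom 1 (Q + S) - monom 1 (R + S) - monom 1 S - 1"
      and c3: "cong3_pm Q R S 1 1 (- 1)"
    have "poly B (- 1 * x) = 1 * ?skew x" for x
      by (simp add: B poly_monom power_add odd)
    note scale = mu_scale_iff[where B = "poly B" and b = ?skew, OF minus_one _ this]
    show ?thesis
      using scale(1) scale(2)[of r] skew(1)[OF c3] skew(2)[OF c3] by simp
  qed
  moreover have "poly f = (\<lambda>x. x ^ r * poly B (x ^ (q - 1)))"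
    by (simp add: assms(12) fun_eq_iff poly_monom poly_pcompose)
  moreover have "bij g \<longleftrightarrow> inj g" for g :: "'a \<Rightarrow> 'a"
    by (auto simp: bij_def finite_UNIV_inj_surj)
  moreover have "Q + R + S > 0"
    using QRS(1) prime_gt_0_nat[OF prime_p] by auto
  ultimately show ?thesis
    using inj_power_poly_iff[OF \<open>r > 0\<close>, of "poly B"] cross_injective_iff[OF \<open>p \<noteq> 3\<close> v]
    unfolding permutation_poly_def by simp
qed

end
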